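(* Let $R$ be a field, let $I$ be an involutive division on the monomials of $R\langle x_1,\dots,x_n\rangle$ that is weak, continuous and Gröbner, and let $O$ be an admissible monomial ordering. If a finite set $P\subset R\langle x_1,\dots,x_n\rangle$ of nonzero polynomials is a Locally Involutive Basis with respect to $I$ and $O$, then $P$ is an Involutive Basis with respect to $I$ and $O$.
   Context: Monomials are words in the noncommuting variables $x_1,\dots,x_n$; a monomial ordering (total order on monomials) is admissible if $1<m$ for all $m\neq 1$ and $m_1<m_2$ implies $\ell m_1 r<\ell m_2 r$ for all monomials $\ell,r$. $\mathrm{LM},\mathrm{LT},\mathrm{LC}$ denote leading monomial, term, coefficient. Involutive division. A rule $I$ assigning to every finite set $U$ of monomials and every $u\in U$ a set $\mathcal M^L_I(u,U)\subseteq\{x_1,\dots,x_n\}$ of left multiplicative variables and a set $\mathcal M^R_I(u,U)\subseteq\{x_1,\dots,x_n\}$ of right multiplicative variables. For $u\in U$ and a factorisation $w=v_1uv_2$, $u$ is an involutive divisor of $w$ at this factorisation if (thin divisors) the last letter of $v_1$ (if $v_1\ne1$) is in $\mathcal M^L_I(u,U)$ and the first letter of $v_2$ (if $v_2\neq1$) is in $\mathcal M^R_I(u,U)$. Write $u\mid_I w$ if this holds for some factorisation, and let $\mathcal C_I(u,U)=\{w : u\mid_I w\}$. $I$ is strong if for every finite $U$: (Disjoint Cones) if $\mathcal C_I(u_1,U)\cap\mathcal C_I(u_2,U)\ne\emptyset$ for $u_1,u_2\in U$, then one of these cones is contained in the other; (Unique Divisor) each $w\in\mathcal C_I(u,U)$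 is involutively divisible by $u$ at exactly one factorisation; (Subset) if $V\subset U$ then $\mathcal M^L_I(v,U)\subseteq\mathcal M^L_I(v,V)$ and $\mathcal M^R_I(v,U)\subseteq\mathcal M^R_I(v,V)$ for all $v\in V$. If any of these fails, $I$ is weak. For a finite set $P$ of nonzero polynomials, multiplicative variables of $p\in P$ are those of $\mathrm{LM}(p)$ with respect to $U=\mathrm{LM}(P)$. Involutive reduction of $f$ by $P$: repeatedly take the leading term $c\,w$ of the current polynomial; if some $\mathrm{LM}(p)$, $p\in P$, involutively divides $w$ at $w=v_1\mathrm{LM}(p)v_2$, subtract $c\,\mathrm{LC}(p)^{-1}v_1pv_2$; otherwise move $c\,w$ to the remainder. $f$ involutively reduces to zero using $P$ if the final remainder is $0$. $P$ is autoreduced if no $p\in P$ contains a term whose monomial is involutively divisible (multiplicative variables taken over $P$) by $\mathrm{LM}(p')$ for some $p'\in P\setminus\{p\}$. A left (right) prolongation of $p\in P$ is $x_ip$ with $x_i\notin\mathcal M^L_I(\mathrm{LM}(p),\mathrm{LM}(P))$ (resp. $px_i$ with $x_i\notin\mathcal M^R_I(\mathrm{LM}(p),\mathrm{LM}(P))$). An autoreduced $P$ is a Locally Involutive Basis if all left and right prolongations of its elements involutively reduce to zero using $P$, and an Involutive Basis if $upv$ involutively reduces to zero using $P$ for all $p\in P$ and all terms $u,v$. A weak involutive division $I$ is Gröbner if every Locally Involutive Basis with respect to $I$ (and any admissible monomial ordering) is a noncommutative Gröbner Basis of the two-sided ideal it generates. Continuity. Let $w$ be a monomial, $U$ a finite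 set of monomials, and $(u_1,\dots,u_k)$ a sequence in $U$ with factorisations $w=\ell_iu_ir_i$. Suppose for each $1\le i<k$ exactly one of the following holds: (a) $\ell_i\neq1$, its last letter $x$ is not in $\mathcal M^L_I(u_i,U)$, and $u_{i+1}$ involutively divides $xu_i$; (b) $r_i\ne1$, its first letter $x$ is not in $\mathcal M^R_I(u_i,U)$, and $u_{i+1}$ involutively divides $u_ix$; where the occurrence of $u_{i+1}$ in $w$ given by $(\ell_{i+1},r_{i+1})$ is the one induced by its occurrence (as involutive divisor) in the prolongation $xu_i$, resp. $u_ix$, located in $w$. $I$ is continuous if for all such data the pairs $(\ell_i,r_i)$ are pairwise distinct. *)

theory Defs
  imports Main "HOL.Hull" "HOL-Library.Poly_Mapping" "HOL-Library.Sublist"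
begin

text \<open>
  A monomial in the noncommuting variables is a word, i.e. a list over a finite type of variables.
  Making lists an additive monoid under concatenation turns the type
  \<open>'x list \<Rightarrow>\<^sub>0 'a\<close> into the free associative algebra: the product of
  \<^typ>\<open>('x list, 'a::field) poly_mapping\<close> is convolution along concatenation of words.
\<close>

instantiation list :: (type) monoid_add
begin

definition zero_list :: "'a list" where "zero_list = []"

definition plus_list :: "'a list \<Rightarrow> 'a list \<Rightarrow> 'a list" where "plus_list xs ys = xs @ ys"

instance by standard (simp_all add: zero_list_def plus_list_def)

end

type_synonym ('x, 'a) ncpoly = "'x list \<Rightarrow>\<^sub>0 'a"

definition two_sided_ideal :: "'r::ring_1 set \<Rightarrow> bool" where
  "two_sided_ideal J \<longleftrightarrow> 0 \<in> J \<and> (\<forall>a\<in>J. \<forall>b\<in>J. a + b \<in> J) \<and>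
     (\<forall>a\<in>J. \<forall>r. r * a \<in> J \<and> a * r \<in> J)"

definition admissible :: "('x list \<Rightarrow> 'x list \<Rightarrow> bool) \<Rightarrow> bool" where
  "admissible prec \<longleftrightarrow> irreflp prec \<and> transp prec \<and> totalp prec \<and>
     (\<forall>m. m \<noteq> [] \<longrightarrow> prec [] m) \<and>
     (\<forall>m1 m2 l r. prec m1 m2 \<longrightarrow> prec (l @ m1 @ r) (l @ m2 @ r))"

text \<open>Meaningful only for nonzero polynomials.\<close>

definition LM :: "('x list \<Rightarrow> 'x list \<Rightarrow> bool) \<Rightarrow> ('x, 'a::field) ncpoly \<Rightarrow> 'x list" where
  "LM prec f = (THE m. m \<in> Poly_Mapping.keys f \<and> (\<forall>m' \<in> Poly_Mapping.keys f. m' \<noteq> m \<longrightarrow> prec m' m))"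

definition LC :: "('x list \<Rightarrow> 'x list \<Rightarrow> bool) \<Rightarrow> ('x, 'a::field) ncpoly \<Rightarrow> 'a" where
  "LC prec f = Poly_Mapping.lookup f (LM prec f)"

definition LT :: "('x list \<Rightarrow> 'x list \<Rightarrow> bool) \<Rightarrow> ('x, 'a::field) ncpoly \<Rightarrow> ('x, 'a) ncpoly" where
  "LT prec f = Poly_Mapping.single (LM prec f) (LC prec f)"

definition groebner_basis :: "('x list \<Rightarrow> 'x list \<Rightarrow> bool) \<Rightarrow> ('x, 'a::field) ncpoly set \<Rightarrow> bool" where
  "groebner_basis prec G \<longleftrightarrow>
     (\<forall>f \<in> two_sided_ideal hull G. f \<noteq> 0 \<longrightarrow> (\<exists>g \<in> G - {0}. sublist (LM prec g) (LM prec f)))"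

text \<open>
  Only the values at a finite set \<open>U\<close> and an element \<open>u\<close> of \<open>U\<close> matter.
\<close>

record 'x division =
  Lmult :: "'x list \<Rightarrow> 'x list set \<Rightarrow> 'x set"
  Rmult :: "'x list \<Rightarrow> 'x list set \<Rightarrow> 'x set"

text \<open>\<open>u\<close> is an involutive divisor of \<open>v1 @ u @ v2\<close> at this factorisation (thin divisors).\<close>

definition inv_divisor_at ::
  "'x division \<Rightarrow> 'x list set \<Rightarrow> 'x list \<Rightarrow> 'x list \<Rightarrow> 'x list \<Rightarrow> bool" where
  "inv_divisor_at I U v1 u v2 \<longleftrightarrow>
     (v1 \<noteq> [] \<longrightarrow> last v1 \<in> Lmult I u U) \<and> (v2 \<noteq> [] \<longrightarrow> hd v2 \<in> Rmult I u U)"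

definition inv_divides :: "'x division \<Rightarrow> 'x list set \<Rightarrow> 'x list \<Rightarrow> 'x list \<Rightarrow> bool" where
  "inv_divides I U u w \<longleftrightarrow> (\<exists>v1 v2. w = v1 @ u @ v2 \<and> inv_divisor_at I U v1 u v2)"

definition inv_cone :: "'x division \<Rightarrow> 'x list set \<Rightarrow> 'x list \<Rightarrow> 'x list set" where
  "inv_cone I U u = {w. inv_divides I U u w}"

definition disjoint_cones :: "'x division \<Rightarrow> 'x list set \<Rightarrow> bool" where
  "disjoint_cones I U \<longleftrightarrow>
     (\<forall>u1\<in>U. \<forall>u2\<in>U. inv_cone I U u1 \<inter> inv_cone I U u2 \<noteq> {} \<longrightarrow>
        inv_cone I U u1 \<subseteq> inv_cone I U u2 \<or> inv_cone I U u2 \<subseteq> inv_cone I U u1)"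

definition unique_divisor :: "'x division \<Rightarrow> 'x list set \<Rightarrow> bool" where
  "unique_divisor I U \<longleftrightarrow>
     (\<forall>u\<in>U. \<forall>w \<in> inv_cone I U u. \<exists>!(v1, v2). w = v1 @ u @ v2 \<and> inv_divisor_at I U v1 u v2)"

definition subset_condition :: "'x division \<Rightarrow> 'x list set \<Rightarrow> bool" where
  "subset_condition I U \<longleftrightarrow>
     (\<forall>V. V \<subseteq> U \<longrightarrow> (\<forall>v\<in>V. Lmult I v U \<subseteq> Lmult I v V \<and> Rmult I v U \<subseteq> Rmult I v V))"

definition strong_division :: "'x division \<Rightarrow> bool" where
  "strong_division I \<longleftrightarrow>
     (\<forall>U. finite U \<longrightarrow> disjoint_cones I U \<and> unique_divisor I U \<and> subset_condition I U)"

definition weak_division :: "'x division \<Rightarrow> bool" where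
  "weak_division I \<longleftrightarrow> \<not> strong_division I"

text \<open>
  \<open>inv_remainder I prec P f r\<close>: some run of involutive reduction of \<open>f\<close> by \<open>P\<close>
  terminates with remainder \<open>r\<close>. A run may choose any available divisor at each step.
\<close>

inductive inv_remainder ::
  "'x division \<Rightarrow> ('x list \<Rightarrow> 'x list \<Rightarrow> bool) \<Rightarrow> ('x, 'a::field) ncpoly set \<Rightarrow>
   ('x, 'a) ncpoly \<Rightarrow> ('x, 'a) ncpoly \<Rightarrow> bool"
  for I prec P where
  done_step: "inv_remainder I prec P 0 0"
| reduce_step: "inv_remainder I prec P f r"
    if "f \<noteq> 0" "p \<in> P" "LM prec f = v1 @ LM prec p @ v2"
      "inv_divisor_at I (LM prec ` P) v1 (LM prec p) v2"
      "inv_remainder I prec P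
         (f - Poly_Mapping.single v1 (LC prec f * inverse (LC prec p)) * p * Poly_Mapping.single v2 1) r"
| move_step: "inv_remainder I prec P f (LT prec f + r)"
    if "f \<noteq> 0" "\<And>p. p \<in> P \<Longrightarrow> \<not> inv_divides I (LM prec ` P) (LM prec p) (LM prec f)"
      "inv_remainder I prec P (f - LT prec f) r"

definition inv_reduces_to_zero ::
  "'x division \<Rightarrow> ('x list \<Rightarrow> 'x list \<Rightarrow> bool) \<Rightarrow> ('x, 'a::field) ncpoly set \<Rightarrow>
   ('x, 'a) ncpoly \<Rightarrow> bool" where
  "inv_reduces_to_zero I prec P f \<longleftrightarrow> inv_remainder I prec P f 0"

definition autoreduced ::
  "'x division \<Rightarrow> ('x list \<Rightarrow> 'x list \<Rightarrow> bool) \<Rightarrow> ('x, 'a::field) ncpoly set \<Rightarrow> bool" where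
  "autoreduced I prec P \<longleftrightarrow>
     (\<forall>p\<in>P. \<forall>t \<in> Poly_Mapping.keys p. \<forall>p' \<in> P - {p}.
        \<not> inv_divides I (LM prec ` P) (LM prec p') t)"

definition locally_involutive_basis ::
  "'x division \<Rightarrow> ('x list \<Rightarrow> 'x list \<Rightarrow> bool) \<Rightarrow> ('x, 'a::field) ncpoly set \<Rightarrow> bool" where
  "locally_involutive_basis I prec P \<longleftrightarrow> autoreduced I prec P \<and>
     (\<forall>p\<in>P. \<forall>x.
        (x \<notin> Lmult I (LM prec p) (LM prec ` P) \<longrightarrow>
           inv_reduces_to_zero I prec P (Poly_Mapping.single [x] 1 * p)) \<and>
        (x \<notin> Rmult I (LM prec p) (LM prec ` P) \<longrightarrow>
           inv_reduces_to_zero I prec P (p * Poly_Mapping.single [x] 1)))"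

definition involutive_basis ::
  "'x division \<Rightarrow> ('x list \<Rightarrow> 'x list \<Rightarrow> bool) \<Rightarrow> ('x, 'a::field) ncpoly set \<Rightarrow> bool" where
  "involutive_basis I prec P \<longleftrightarrow> autoreduced I prec P \<and>
     (\<forall>p\<in>P. \<forall>u v c d.
        inv_reduces_to_zero I prec P (Poly_Mapping.single u c * p * Poly_Mapping.single v d))"

text \<open>The coefficient field is not determined by the division and is passed as a type argument.\<close>

definition groebner_division :: "'a::field itself \<Rightarrow> 'x division \<Rightarrow> bool" where
  "groebner_division _ I \<longleftrightarrow>
     (\<forall>prec (P :: ('x, 'a) ncpoly set).
        admissible prec \<and> finite P \<and> 0 \<notin> P \<and> locally_involutive_basis I prec P \<longrightarrow>
        groebner_basis prec P)"

text \<open>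
  A triple \<open>(l, u, r)\<close> stands for the occurrence of \<open>u\<close> in \<open>w = l @ u @ r\<close>. In a step to
  \<open>(l', u', r')\<close>, the word \<open>u'\<close> involutively divides a nonmultiplicative prolongation of
  \<open>u\<close> inside \<open>w\<close>, at a factorisation \<open>v1 @ u' @ v2\<close> which induces \<open>l'\<close> and \<open>r'\<close>.
\<close>

definition left_step ::
  "'x division \<Rightarrow> 'x list set \<Rightarrow> 'x list \<times> 'x list \<times> 'x list \<Rightarrow>
   'x list \<times> 'x list \<times> 'x list \<Rightarrow> bool" where
  "left_step I U = (\<lambda>(l, u, r) (l', u', r').
     l \<noteq> [] \<and> last l \<notin> Lmult I u U \<and>
     (\<exists>v1 v2. last l # u = v1 @ u' @ v2 \<and> inv_divisor_at I U v1 u' v2 \<and>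
        l' = butlast l @ v1 \<and> r' = v2 @ r))"

definition right_step ::
  "'x division \<Rightarrow> 'x list set \<Rightarrow> 'x list \<times> 'x list \<times> 'x list \<Rightarrow>
   'x list \<times> 'x list \<times> 'x list \<Rightarrow> bool" where
  "right_step I U = (\<lambda>(l, u, r) (l', u', r').
     r \<noteq> [] \<and> hd r \<notin> Rmult I u U \<and>
     (\<exists>v1 v2. u @ [hd r] = v1 @ u' @ v2 \<and> inv_divisor_at I U v1 u' v2 \<and>
        l' = l @ v1 \<and> r' = v2 @ tl r))"

text \<open>The disequality of truth values says that exactly one of the two kinds of step applies.\<close>

definition continuous_division :: "'x division \<Rightarrow> bool" where
  "continuous_division I \<longleftrightarrow>
     (\<forall>w U (k::nat) l u r.
        finite U \<and> (\<forall>i<k. u i \<in> U \<and> w = l i @ u i @ r i) \<and>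
        (\<forall>i. Suc i < k \<longrightarrow>
           left_step I U (l i, u i, r i) (l (Suc i), u (Suc i), r (Suc i)) \<noteq>
           right_step I U (l i, u i, r i) (l (Suc i), u (Suc i), r (Suc i))) \<longrightarrow>
        inj_on (\<lambda>i. (l i, r i)) {..<k})"

end

theory Submission
  imports Defs "HOL-Library.Infinite_Set"
begin

text \<open>
  Every word containing some \<open>LM p\<close> has an involutive divisor: as long as the current occurrence
  is not an involutive one, a nonmultiplicative prolongation is reducible (it reduces to zero), which
  yields the next occurrence; by continuity these occurrences never repeat, and there are only
  finitely many. Since \<open>P\<close> is a Groebner basis, every nonzero element of the ideal therefore admits
  an involutive reduction step, which stays in the ideal and lowers the leading monomial. Admissible
  orderings on words over a finite alphabet are well-founded, so this ends at zero.
\<close>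

section \<open>Admissible orderings\<close>

lemma admissible_irrefl: "admissible prec \<Longrightarrow> \<not> prec m m"
  unfolding admissible_def by (blast dest: irreflpD)

lemma admissible_trans: "admissible prec \<Longrightarrow> prec m1 m2 \<Longrightarrow> prec m2 m3 \<Longrightarrow> prec m1 m3"
  unfolding admissible_def by (blast dest: transpD)

lemma admissible_total: "admissible prec \<Longrightarrow> m1 \<noteq> m2 \<Longrightarrow> prec m1 m2 \<or> prec m2 m1"
  unfolding admissible_def by (blast dest: totalpD)

lemma admissible_Nil: "admissible prec \<Longrightarrow> m \<noteq> [] \<Longrightarrow> prec [] m"
  unfolding admissible_def by blast

lemma admissible_mult: "admissible prec \<Longrightarrow> prec m1 m2 \<Longrightarrow> prec (l @ m1 @ r) (l @ m2 @ r)"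
  unfolding admissible_def by blast

lemma admissible_Cons_cancel:
  assumes adm: "admissible prec" and "prec (a # v) (a # w)"
  shows "prec v w"
proof (rule ccontr)
  assume "\<not> prec v w"
  then have "v = w \<or> prec w v" using admissible_total[OF adm] by blast
  then have "v = w \<or> prec (a # w) (a # v)"
    using admissible_mult[OF adm, of w v "[a]" "[]"] by auto
  then show False
    using assms(2) admissible_irrefl[OF adm] admissible_trans[OF adm] by blast
qed

lemma admissible_Cons_greater:
  assumes "admissible prec"
  shows "prec w (a # w)"
  using admissible_mult[OF assms admissible_Nil[OF assms, of "[a]"], of "[]" w] by simp

text \<open>
  A minimal bad sequence argument as in Higman's lemma: in a descending sequence of shortest possible
  words, infinitely many start with the same letter, and deleting that letter from these gives a
  shorter descending sequence.
\<close>

lemma admissible_wfp: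
  fixes prec :: "'x::finite list \<Rightarrow> 'x list \<Rightarrow> bool"
  assumes adm: "admissible prec"
  shows "wfp prec"
proof (rule ccontr)
  assume "\<not> wfp prec"
  then obtain b where b: "\<not> Wellfounded.accp prec b"
    unfolding wfp_iff_accp by blast
  define pick where "pick A = arg_min length (\<lambda>w. w \<in> A)" for A :: "'x list set"
  have pick: "pick A \<in> A \<and> (\<forall>v\<in>A. length (pick A) \<le> length v)" if "A \<noteq> {}" for A
    using that arg_min_nat_lemma[of "\<lambda>w. w \<in> A" _ length] unfolding pick_def by blast
  define B where "B = {w. \<not> Wellfounded.accp prec w}"
  define below where "below v = {w \<in> B. prec w v}" for v
  have below_ne: "below v \<noteq> {}" if "v \<in> B" for v
    using that unfolding below_def B_def by (auto elim: not_accp_down)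
  \<comment> \<open>Each term is a shortest inaccessible word below its predecessor. The sequence
    never stops, because below an inaccessible word there is always another one.\<close>
  define s where "s = rec_nat (pick B) (\<lambda>_ v. pick (below v))"
  have s_0: "s 0 = pick B" and s_Suc: "s (Suc n) = pick (below (s n))" for n
    by (simp_all add: s_def)
  have s_in: "s n \<in> B" for n
  proof (induction n)
    case 0
    show ?case using pick[of B] b unfolding s_0 B_def by blast
  next
    case (Suc n)
    then show ?case using pick[OF below_ne[OF Suc]] unfolding s_Suc below_def by blast
  qed
  have step: "prec (s (Suc n)) (s n)" for n
    using pick[OF below_ne[OF s_in[of n]]] unfolding s_Suc below_def by blast
  have desc: "prec (s j) (s i)" if "i < j" for i j
    using that
  proof (induction j)
    case (Suc j)
    then show ?case using step[of j] admissible_trans[OF adm] by (metis less_Suc_eq)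
  qed simp
  \<comment> \<open>Length was minimised only below the preceding term, but by transitivity whatever
    lies below \<open>s n\<close> lies below that term as well.\<close>
  have shortest: "length (s n) \<le> length v" if "v \<in> B" "prec v (s n)" for n v
  proof (cases n)
    case 0
    then show ?thesis using pick[of B] that unfolding 0 s_0 by blast
  next
    case (Suc k)
    then have "v \<in> below (s k)"
      using that admissible_trans[OF adm _ step] unfolding below_def by blast
    then show ?thesis using pick[of "below (s k)"] unfolding Suc s_Suc by blast
  qed
  have s_ne: "s n \<noteq> []" for n
    using step[of n] admissible_Nil[OF adm] admissible_irrefl[OF adm] admissible_trans[OF adm]
    by metis
  obtain n0 where inf: "infinite {n \<in> UNIV. hd (s n) = hd (s n0)}"
    using pigeonhole_infinite[of "UNIV :: nat set" "\<lambda>n. hd (s n)"] by auto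
  define N where "N = {n. hd (s n) = hd (s n0)}"
  \<comment> \<open>Induction on accessibility: for any later \<open>m\<close> in \<open>N\<close>
    the common first letter cancels, so the tail of \<open>s m\<close> lies below that of
    \<open>s n\<close> and is excluded by the induction hypothesis.\<close>
  have tails: "\<forall>n\<in>N. t \<noteq> tl (s n)" if "Wellfounded.accp prec t" for t
    using that
  proof (induction rule: accp.induct)
    case (accI t)
    show ?case
    proof (intro ballI notI)
      fix n assume n: "n \<in> N" "t = tl (s n)"
      obtain m where m: "m \<in> N" "n < m"
        using inf unfolding N_def infinite_nat_iff_unbounded by auto
      have "hd (s n0) # tl (s m) = s m" "hd (s n0) # tl (s n) = s n"
        using s_ne m(1) n(1) unfolding N_def by (metis (mono_tags) list.collapse mem_Collect_eq)+
      then have "prec (tl (s m)) (tl (s n))"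
        using desc[OF m(2)] admissible_Cons_cancel[OF adm] by metis
      then show False using accI.IH m(1) n(2) by blast
    qed
  qed
  \<comment> \<open>This tail is an inaccessible word below \<open>s n0\<close> and shorter than it,
    against \<open>shortest\<close>.\<close>
  have "tl (s n0) \<in> B" using tails unfolding B_def N_def by blast
  moreover have "prec (tl (s n0)) (s n0)"
    using admissible_Cons_greater[OF adm, of "tl (s n0)" "hd (s n0)"] s_ne by simp
  ultimately have "length (s n0) \<le> length (tl (s n0))" by (rule shortest)
  then show False using s_ne[of n0] by (cases "s n0") auto
qed

section \<open>Leading monomials\<close>

lemma LM_eqI:
  assumes "admissible prec" "m \<in> Poly_Mapping.keys f"
    "\<And>m'. m' \<in> Poly_Mapping.keys f \<Longrightarrow> m' \<noteq> m \<Longrightarrow> prec m' m"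
  shows "LM prec f = m"
  unfolding LM_def
proof (rule the_equality)
  show "m \<in> Poly_Mapping.keys f \<and> (\<forall>m'\<in>Poly_Mapping.keys f. m' \<noteq> m \<longrightarrow> prec m' m)"
    using assms(2,3) by simp
  show "k = m" if k: "k \<in> Poly_Mapping.keys f \<and> (\<forall>m'\<in>Poly_Mapping.keys f. m' \<noteq> k \<longrightarrow> prec m' k)" for k
  proof (rule ccontr)
    assume "k \<noteq> m"
    then have "prec k m" "prec m k" using k assms(2,3) by simp_all
    then show False
      using admissible_irrefl[OF assms(1)] admissible_trans[OF assms(1)] by blast
  qed
qed

lemma finite_has_greatest:
  assumes adm: "admissible prec" and "finite A" "A \<noteq> {}"
  shows "\<exists>m\<in>A. \<forall>m'\<in>A. m' \<noteq> m \<longrightarrow> prec m' m"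
  using assms(2,3)
proof (induction rule: finite_ne_induct)
  case (insert x A)
  then obtain m where "m \<in> A" "\<forall>m'\<in>A. m' \<noteq> m \<longrightarrow> prec m' m" by blast
  with insert(3) show ?case
    using admissible_total[OF adm, of x m] admissible_trans[OF adm] by (metis insert_iff)
qed simp

lemma LM_greatest:
  assumes adm: "admissible prec" and "f \<noteq> 0"
  shows LM_in_keys: "LM prec f \<in> Poly_Mapping.keys f"
    and keys_below_LM: "m \<in> Poly_Mapping.keys f \<Longrightarrow> m \<noteq> LM prec f \<Longrightarrow> prec m (LM prec f)"
proof -
  obtain m where "m \<in> Poly_Mapping.keys f"
      "\<forall>m'\<in>Poly_Mapping.keys f. m' \<noteq> m \<longrightarrow> prec m' m"
    using finite_has_greatest[OF adm, of "Poly_Mapping.keys f"] assms(2) by auto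
  moreover from this have "LM prec f = m" by (intro LM_eqI[OF adm]) blast+
  ultimately show "LM prec f \<in> Poly_Mapping.keys f"
    "m \<in> Poly_Mapping.keys f \<Longrightarrow> m \<noteq> LM prec f \<Longrightarrow> prec m (LM prec f)" for m
    by blast+
qed

lemma LC_nonzero: "admissible prec \<Longrightarrow> f \<noteq> 0 \<Longrightarrow> LC prec f \<noteq> 0"
  unfolding LC_def using LM_in_keys[of prec f] by (simp add: in_keys_iff)

lemma keys_diff_LT: "Poly_Mapping.keys (f - LT prec f) = Poly_Mapping.keys f - {LM prec f}"
  unfolding LT_def LC_def by (auto simp: in_keys_iff lookup_minus lookup_single when_def split: if_splits)

lemma keys_single_times_single:
  fixes p :: "('x, 'a::field) ncpoly"
  assumes "m \<in> Poly_Mapping.keys (Poly_Mapping.single u c * p * Poly_Mapping.single v d)"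
  obtains k where "k \<in> Poly_Mapping.keys p" "m = u @ k @ v"
proof -
  obtain a b where ab: "m = a + b" "a \<in> Poly_Mapping.keys (Poly_Mapping.single u c * p)"
      "b \<in> Poly_Mapping.keys (Poly_Mapping.single v d)"
    using subsetD[OF keys_mult assms] by blast
  obtain a' k where "a = a' + k" "a' \<in> Poly_Mapping.keys (Poly_Mapping.single u c)"
      "k \<in> Poly_Mapping.keys p"
    using subsetD[OF keys_mult ab(2)] by blast
  with ab that[of k] show thesis by (auto simp: plus_list_def split: if_splits)
qed

text \<open>Since \<open>m\<close> can be recovered from \<open>u @ m @ v\<close>, no other term of
  \<open>p\<close> contributes to this coefficient: \<open>q\<close> below is \<open>p\<close>
  without its term at \<open>m\<close>.\<close>

lemma lookup_single_times_single:
  fixes p :: "('x, 'a::field) ncpoly"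
  shows "Poly_Mapping.lookup (Poly_Mapping.single u c * p * Poly_Mapping.single v d) (u @ m @ v) =
    c * Poly_Mapping.lookup p m * d"
proof -
  define e where "e = Poly_Mapping.lookup p m"
  define q where "q = p - Poly_Mapping.single m e"
  have "u @ m @ v \<notin> Poly_Mapping.keys (Poly_Mapping.single u c * q * Poly_Mapping.single v d)"
  proof
    assume "u @ m @ v \<in> Poly_Mapping.keys (Poly_Mapping.single u c * q * Poly_Mapping.single v d)"
    then obtain k where "k \<in> Poly_Mapping.keys q" "u @ m @ v = u @ k @ v"
      by (rule keys_single_times_single)
    then show False by (simp add: q_def e_def in_keys_iff lookup_minus)
  qed
  moreover have "Poly_Mapping.single u c * p * Poly_Mapping.single v d =
      Poly_Mapping.single (u @ m @ v) (c * e * d) +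
      Poly_Mapping.single u c * q * Poly_Mapping.single v d"
    by (simp add: q_def algebra_simps mult_single plus_list_def)
  ultimately show ?thesis
    unfolding not_in_keys_iff_lookup_eq_zero by (simp add: lookup_add e_def)
qed

text \<open>Admissibility preserves comparisons under two-sided multiplication, and the leading
  coefficient survives because a field has no zero divisors.\<close>

lemma LM_single_times_single:
  fixes p :: "('x, 'a::field) ncpoly"
  assumes adm: "admissible prec" and "p \<noteq> 0" "c \<noteq> 0" "d \<noteq> 0"
  shows "LM prec (Poly_Mapping.single u c * p * Poly_Mapping.single v d) = u @ LM prec p @ v"
    and "Poly_Mapping.single u c * p * Poly_Mapping.single v d \<noteq> 0"
proof -
  let ?f = "Poly_Mapping.single u c * p * Poly_Mapping.single v d"
  have key: "u @ LM prec p @ v \<in> Poly_Mapping.keys ?f"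
    using assms LC_nonzero[OF adm assms(2)]
    by (simp add: in_keys_iff lookup_single_times_single LC_def)
  then show "?f \<noteq> 0" by auto
  show "LM prec ?f = u @ LM prec p @ v"
    by (rule LM_eqI[OF adm key])
      (auto elim!: keys_single_times_single intro!: admissible_mult[OF adm] keys_below_LM[OF adm assms(2)])
qed

section \<open>Involutive reduction\<close>

text \<open>A reduction step introduces only words up to the leading monomial, and a moved term is
  the leading one, so a strict upper bound survives every step.\<close>

lemma inv_remainder_keys_below:
  assumes "inv_remainder I prec P f r" and adm: "admissible prec" and "0 \<notin> P"
    and "\<forall>k\<in>Poly_Mapping.keys f. prec k m"
  shows "\<forall>k\<in>Poly_Mapping.keys r. prec k m"
  using assms(1,4)
proof (induction rule: inv_remainder.induct)
  case done_step
  then show ?case by simp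
next
  case (reduce_step f p v1 v2 r)
  have "p \<noteq> 0" using reduce_step(2) assms(3) by blast
  let ?q = "Poly_Mapping.single v1 (LC prec f * inverse (LC prec p)) * p * Poly_Mapping.single v2 1"
  have "prec k m" if "k \<in> Poly_Mapping.keys ?q" for k
  proof -
    from that obtain k' where "k' \<in> Poly_Mapping.keys p" "k = v1 @ k' @ v2"
      by (rule keys_single_times_single)
    then have "k = LM prec f \<or> prec k (LM prec f)"
      unfolding reduce_step(3)
      using keys_below_LM[OF adm \<open>p \<noteq> 0\<close>] admissible_mult[OF adm] by blast
    then show ?thesis
      using reduce_step(1) reduce_step.prems LM_in_keys[OF adm] admissible_trans[OF adm] by blast
  qed
  then show ?case
    using reduce_step.IH reduce_step.prems keys_diff[of f ?q] by blast
next
  case (move_step f r)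
  have "\<forall>k\<in>Poly_Mapping.keys r. prec k m"
    using move_step.IH move_step.prems by (simp add: keys_diff_LT)
  moreover have "Poly_Mapping.keys (LT prec f) \<subseteq> {LM prec f}" unfolding LT_def by simp
  ultimately show ?case
    using move_step(1) move_step.prems LM_in_keys[OF adm] keys_add[of "LT prec f" r] by blast
qed

text \<open>Had the first step moved the leading term, the rest of the remainder would consist of
  smaller words and could not cancel it.\<close>

lemma inv_reduces_to_zero_reducible:
  assumes "inv_reduces_to_zero I prec P f" and adm: "admissible prec" and "0 \<notin> P" and "f \<noteq> 0"
  shows "\<exists>p\<in>P. inv_divides I (LM prec ` P) (LM prec p) (LM prec f)"
  using assms(1)[unfolded inv_reduces_to_zero_def]
proof (cases rule: inv_remainder.cases)
  case done_step
  then show ?thesis using assms by simp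
next
  case (reduce_step p v1 v2)
  then show ?thesis unfolding inv_divides_def by blast
next
  case (move_step r)
  have "\<forall>k\<in>Poly_Mapping.keys (f - LT prec f). prec k (LM prec f)"
    using keys_below_LM[OF adm assms(4)] by (simp add: keys_diff_LT)
  then have "LM prec f \<notin> Poly_Mapping.keys r"
    using inv_remainder_keys_below[OF move_step(4) adm assms(3)] admissible_irrefl[OF adm] by blast
  then have "Poly_Mapping.lookup (LT prec f + r) (LM prec f) = LC prec f"
    by (simp add: LT_def lookup_add in_keys_iff)
  then show ?thesis using move_step(1) LC_nonzero[OF adm assms(4)] by simp
qed

section \<open>Involutive divisors from continuity\<close>

text \<open>Continuity asks for exactly one kind of step, so steps of both kinds at once have to be
  excluded.\<close>

lemma not_left_and_right_step:
  assumes "\<not> (inv_divides I U u' u \<and> u' \<noteq> u)"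
  shows "\<not> (left_step I U (l, u, r) (l', u', r') \<and> right_step I U (l, u, r) (l', u', r'))"
proof
  assume *: "left_step I U (l, u, r) (l', u', r') \<and> right_step I U (l, u, r) (l', u', r')"
  then obtain v1 v2 where left: "l \<noteq> []" "last l \<notin> Lmult I u U" "last l # u = v1 @ u' @ v2"
      "inv_divisor_at I U v1 u' v2" "l' = butlast l @ v1"
    unfolding left_step_def by auto
  \<comment> \<open>Both kinds of step induce the same \<open>l'\<close>. By the right step
    \<open>u'\<close> starts no earlier than \<open>u\<close>, and by the left step it ends no
    later, so it lies inside \<open>u\<close>.\<close>
  from * obtain l1 where "l' = l @ l1"
    unfolding right_step_def by auto
  with left(1,5) have "v1 = last l # l1"
    by (metis append.assoc append_butlast_last_id append_Cons append_Nil same_append_eq)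
  with left have "u = l1 @ u' @ v2" and at: "inv_divisor_at I U (last l # l1) u' v2"
    by simp_all
  \<comment> \<open>If \<open>l1\<close> is nonempty, its last letter is that of
    \<open>last l # l1\<close>, so the condition on the left carries over.\<close>
  moreover from this have "inv_divides I U u' u"
    unfolding inv_divides_def inv_divisor_at_def by (auto split: if_splits)
  ultimately have "u' = u" using assms by blast
  \<comment> \<open>Now \<open>u\<close> divides its own prolongation with
    \<open>v1 = [last l]\<close>, which makes \<open>last l\<close> multiplicative, contrary to the
    left step.\<close>
  then have "l1 = []" using arg_cong[OF \<open>u = l1 @ u' @ v2\<close>, of length] by simp
  with at left(2) \<open>u' = u\<close> show False unfolding inv_divisor_at_def by simp
qed

text \<open>The hypotheses \<open>autored\<close>, \<open>left\<close> and \<open>right\<close>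
  record what a Locally Involutive Basis says about its leading monomials, so that the argument
  concerns words only.\<close>

lemma continuous_inv_divisor_exists:
  assumes cont: "continuous_division I" and "finite U"
    and autored: "\<And>u u'. u \<in> U \<Longrightarrow> u' \<in> U \<Longrightarrow> inv_divides I U u' u \<Longrightarrow> u' = u"
    and left: "\<And>u x. u \<in> U \<Longrightarrow> x \<notin> Lmult I u U \<Longrightarrow> \<exists>u'\<in>U. inv_divides I U u' (x # u)"
    and right: "\<And>u x. u \<in> U \<Longrightarrow> x \<notin> Rmult I u U \<Longrightarrow> \<exists>u'\<in>U. inv_divides I U u' (u @ [x])"
    and "u0 \<in> U" "sublist u0 w"
  shows "\<exists>u\<in>U. inv_divides I U u w"
proof (rule ccontr)
  assume none: "\<not> ?thesis"
  define occ where "occ = (\<lambda>(l, u, r). u \<in> U \<and> w = l @ u @ r)"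
  define follows where "follows s t \<longleftrightarrow> left_step I U s t \<noteq> right_step I U s t" for s t
  have next_occ: "\<exists>t. occ t \<and> follows s t" if "occ s" for s
  proof -
    obtain l u r where s: "s = (l, u, r)" by (cases s)
    with that have u: "u \<in> U" "w = l @ u @ r" unfolding occ_def by auto
    then have "\<not> inv_divisor_at I U l u r" using none unfolding inv_divides_def by blast
    then consider "l \<noteq> []" "last l \<notin> Lmult I u U" | "r \<noteq> []" "hd r \<notin> Rmult I u U"
      unfolding inv_divisor_at_def by blast
    then have "\<exists>t. occ t \<and> (left_step I U s t \<or> right_step I U s t)"
    proof cases
      case 1
      then obtain u' v1 v2 where d: "u' \<in> U" "last l # u = v1 @ u' @ v2" "inv_divisor_at I U v1 u' v2"
        using left[OF u(1)] unfolding inv_divides_def by blast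
      have "w = butlast l @ (last l # u) @ r" using u(2) 1(1) by simp
      then have "occ (butlast l @ v1, u', v2 @ r)" unfolding occ_def d(2) using d(1) by simp
      then show ?thesis unfolding left_step_def s using 1 d by blast
    next
      case 2
      then obtain u' v1 v2 where d: "u' \<in> U" "u @ [hd r] = v1 @ u' @ v2" "inv_divisor_at I U v1 u' v2"
        using right[OF u(1)] unfolding inv_divides_def by blast
      have "w = l @ (u @ [hd r]) @ tl r" using u(2) 2(1) by simp
      then have "occ (l @ v1, u', v2 @ tl r)" unfolding occ_def d(2) using d(1) by simp
      then show ?thesis unfolding right_step_def s using 2 d by blast
    qed
    then obtain l' u' r' where t: "occ (l', u', r')"
        "left_step I U s (l', u', r') \<or> right_step I U s (l', u', r')"
      by auto
    \<comment> \<open>Autoreduction makes the step one of exactly one kind.\<close>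
    then have "\<not> (inv_divides I U u' u \<and> u' \<noteq> u)"
      using autored[OF u(1)] unfolding occ_def by auto
    with t show ?thesis
      unfolding follows_def s using not_left_and_right_step[of I U u' u] by blast
  qed
  obtain l0 r0 where "occ (l0, u0, r0)" using assms(6,7) unfolding occ_def sublist_def by auto
  then obtain s where s: "\<And>n. occ (s n)" "\<And>n. follows (s n) (s (Suc n))"
    using dependent_nat_choice[of "\<lambda>_. occ" "\<lambda>_. follows"] next_occ by blast
  \<comment> \<open>In each occurrence \<open>l\<close> is a prefix and \<open>r\<close> a suffix of
    \<open>w\<close>, so \<open>S\<close> contains all pairs; taking one occurrence more than
    \<open>S\<close> has elements contradicts injectivity.\<close>
  define S where "S = set (prefixes w) \<times> set (suffixes w)"
  define k where "k = Suc (card S)"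
  have "w = fst (s i) @ fst (snd (s i)) @ snd (snd (s i)) \<and> fst (snd (s i)) \<in> U" for i
    using s(1)[of i] unfolding occ_def by (auto split: prod.splits)
  moreover from this have "(fst (s i), snd (snd (s i))) \<in> S" for i
    unfolding S_def by (auto simp: prefix_def suffix_def) (metis append.assoc)+
  ultimately have "inj_on (\<lambda>i. (fst (s i), snd (snd (s i)))) {..<k}"
      and "(\<lambda>i. (fst (s i), snd (snd (s i)))) ` {..<k} \<subseteq> S"
    using cont[unfolded continuous_division_def, rule_format,
        of U k "\<lambda>i. fst (snd (s i))" w "\<lambda>i. fst (s i)" "\<lambda>i. snd (snd (s i))"]
      s(2) assms(2) by (auto simp: follows_def)
  then have "card {..<k} \<le> card S" by (rule card_inj_on_le) (simp add: S_def)
  then show False unfolding k_def by simp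
qed

lemma locally_involutive_basis_inv_divisor_exists:
  assumes "continuous_division I" and adm: "admissible prec" and "finite P" "0 \<notin> P"
    and lib: "locally_involutive_basis I prec P"
    and "p \<in> P" "sublist (LM prec p) w"
  shows "\<exists>q\<in>P. inv_divides I (LM prec ` P) (LM prec q) w"
proof -
  let ?U = "LM prec ` P"
  have nz: "q \<noteq> 0" if "q \<in> P" for q using that assms(4) by blast
  have "\<exists>u\<in>?U. inv_divides I ?U u w"
  proof (rule continuous_inv_divisor_exists[OF assms(1)])
    show "u' = u" if u: "u \<in> ?U" "u' \<in> ?U" "inv_divides I ?U u' u" for u u'
    proof -
      obtain q q' where q: "q \<in> P" "u = LM prec q" "q' \<in> P" "u' = LM prec q'" using u by auto
      \<comment> \<open>Autoreduction speaks of all monomials of \<open>q\<close>; here it is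
        applied to the leading one.\<close>
      then have "u \<in> Poly_Mapping.keys q" using LM_in_keys[OF adm nz] by blast
      then have "q' = q"
        using lib q(1,3) u(3) unfolding locally_involutive_basis_def autoreduced_def q(4) by blast
      then show ?thesis using q by simp
    qed
  next
    fix u x assume u: "u \<in> ?U" "x \<notin> Lmult I u ?U"
    then obtain q where q: "q \<in> P" "u = LM prec q" by auto
    let ?f = "Poly_Mapping.single [x] 1 * q"
    \<comment> \<open>The empty word is the unit, so the one-sided product is an instance of the
      two-sided one.\<close>
    have f: "?f = Poly_Mapping.single [x] 1 * q * Poly_Mapping.single [] 1"
      by (simp flip: zero_list_def)
    have "inv_reduces_to_zero I prec P ?f"
      using lib q u(2) unfolding locally_involutive_basis_def by blast
    moreover have "LM prec ?f = x # u" "?f \<noteq> 0"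
      using LM_single_times_single[OF adm nz[OF q(1)], of 1 1 "[x]" "[]"] q(2) by (simp_all flip: f)
    ultimately show "\<exists>u'\<in>?U. inv_divides I ?U u' (x # u)"
      using inv_reduces_to_zero_reducible[OF _ adm assms(4), of I ?f] by auto
  next
    fix u x assume u: "u \<in> ?U" "x \<notin> Rmult I u ?U"
    then obtain q where q: "q \<in> P" "u = LM prec q" by auto
    let ?f = "q * Poly_Mapping.single [x] 1"
    have f: "?f = Poly_Mapping.single [] 1 * q * Poly_Mapping.single [x] 1"
      by (simp flip: zero_list_def)
    have "inv_reduces_to_zero I prec P ?f"
      using lib q u(2) unfolding locally_involutive_basis_def by blast
    moreover have "LM prec ?f = u @ [x]" "?f \<noteq> 0"
      using LM_single_times_single[OF adm nz[OF q(1)], of 1 1 "[]" "[x]"] q(2) by (simp_all flip: f)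
    ultimately show "\<exists>u'\<in>?U. inv_divides I ?U u' (u @ [x])"
      using inv_reduces_to_zero_reducible[OF _ adm assms(4), of I ?f] by auto
  qed (use assms(3,6,7) in auto)
  then show ?thesis by blast
qed

section \<open>Reduction of ideal elements\<close>

lemma two_sided_ideal_hull: "two_sided_ideal (two_sided_ideal hull S)"
  by (rule hull_in) (auto simp: two_sided_ideal_def)

lemma two_sided_ideal_mult_mult: "two_sided_ideal J \<Longrightarrow> a \<in> J \<Longrightarrow> r * a * s \<in> J"
  unfolding two_sided_ideal_def by blast

lemma two_sided_ideal_diff: "two_sided_ideal J \<Longrightarrow> a \<in> J \<Longrightarrow> b \<in> J \<Longrightarrow> a - b \<in> J"
  using two_sided_ideal_mult_mult[of J b "-1" 1] unfolding two_sided_ideal_def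
  by (metis diff_conv_add_uminus mult.right_neutral mult_minus1)

text \<open>Each step subtracts an ideal element from an ideal element, so \<open>red\<close>
  applies again and no term is ever moved to the remainder.\<close>

lemma two_sided_ideal_inv_reduces_to_zero:
  fixes P :: "('x::finite, 'a::field) ncpoly set"
  assumes adm: "admissible prec" and "0 \<notin> P"
    and red: "\<And>f. f \<in> two_sided_ideal hull P \<Longrightarrow> f \<noteq> 0 \<Longrightarrow>
      \<exists>p\<in>P. inv_divides I (LM prec ` P) (LM prec p) (LM prec f)"
    and "f \<in> two_sided_ideal hull P"
  shows "inv_reduces_to_zero I prec P f"
proof -
  \<comment> \<open>\<open>LM\<close> has no meaningful value at 0, so the zero polynomial may turn
    up at any \<open>m\<close>; it is settled without the induction hypothesis.\<close>
  have "\<forall>f \<in> two_sided_ideal hull P. LM prec f = m \<longrightarrow> inv_remainder I prec P f 0" for m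
  proof (induction m rule: wfp_induct_rule[OF admissible_wfp[OF adm]])
    case (1 m)
    show ?case
    proof (intro ballI impI)
      fix f assume f: "f \<in> two_sided_ideal hull P" "LM prec f = m"
      show "inv_remainder I prec P f 0"
      proof (cases "f = 0")
        case True
        then show ?thesis by (simp add: done_step)
      next
        case False
        obtain p v1 v2 where p: "p \<in> P" "LM prec f = v1 @ LM prec p @ v2"
            "inv_divisor_at I (LM prec ` P) v1 (LM prec p) v2"
          using red[OF f(1) False] unfolding inv_divides_def by blast
        have "p \<noteq> 0" using p(1) assms(2) by blast
        \<comment> \<open>This scalar gives \<open>q\<close> the leading term of \<open>f\<close>,
          so that the two cancel in \<open>f - q\<close>.\<close>
        define c where "c = LC prec f * inverse (LC prec p)"
        define q where "q = Poly_Mapping.single v1 c * p * Poly_Mapping.single v2 1"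
        have "c \<noteq> 0" using LC_nonzero[OF adm False] LC_nonzero[OF adm \<open>p \<noteq> 0\<close>] by (simp add: c_def)
        have q: "LM prec q = m" "q \<noteq> 0"
          using LM_single_times_single[OF adm \<open>p \<noteq> 0\<close> \<open>c \<noteq> 0\<close>, of 1 v1 v2] p(2) f(2)
          unfolding q_def by simp_all
        have "m = v1 @ LM prec p @ v2" using f(2) p(2) by simp
        then have "Poly_Mapping.lookup q m = c * LC prec p"
          by (simp add: q_def lookup_single_times_single LC_def)
        also have "\<dots> = LC prec f"
          using LC_nonzero[OF adm \<open>p \<noteq> 0\<close>] by (simp add: c_def)
        finally have "Poly_Mapping.lookup q m = LC prec f" .
        then have "m \<notin> Poly_Mapping.keys (f - q)"
          using f(2) by (simp add: in_keys_iff lookup_minus LC_def)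
        then have below: "prec k m" if "k \<in> Poly_Mapping.keys (f - q)" for k
        proof -
          have "k \<noteq> LM prec f" "k \<noteq> LM prec q" using that f(2) q(1) \<open>m \<notin> _\<close> by auto
          moreover have "k \<in> Poly_Mapping.keys f \<or> k \<in> Poly_Mapping.keys q"
            using that keys_diff[of f q] by blast
          ultimately show ?thesis
            using keys_below_LM[OF adm False] keys_below_LM[OF adm q(2)] f(2) q(1) by auto
        qed
        have "q \<in> two_sided_ideal hull P"
          unfolding q_def using two_sided_ideal_mult_mult[OF two_sided_ideal_hull] hull_inc[OF p(1)]
          by blast
        then have "f - q \<in> two_sided_ideal hull P"
          using two_sided_ideal_diff[OF two_sided_ideal_hull f(1)] by blast
        moreover have "f - q = 0 \<or> prec (LM prec (f - q)) m"
          using below LM_in_keys[OF adm, of "f - q"] by blast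
        ultimately have "inv_remainder I prec P (f - q) 0"
          using 1 done_step[of I prec P] by auto
        then show ?thesis
          using reduce_step[OF False p] unfolding q_def c_def by blast
      qed
    qed
  qed
  with assms(4) show ?thesis unfolding inv_reduces_to_zero_def by blast
qed

theorem proposition5p4p7:
  fixes I :: "'x::finite division"
    and prec :: "'x list \<Rightarrow> 'x list \<Rightarrow> bool"
    and P :: "('x, 'a::field) ncpoly set"
  assumes "weak_division I"
    and "continuous_division I"
    and "groebner_division TYPE('a) I"
    and "admissible prec"
    and "finite P"
    and "0 \<notin> P"
    and "locally_involutive_basis I prec P"
  shows "involutive_basis I prec P"
proof -
  have "groebner_basis prec P"
    using assms(3-7) unfolding groebner_division_def by blast
  \<comment> \<open>The Groebner property gives an ordinary divisor of the leading monomial;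
    continuity turns it into an involutive one.\<close>
  then have "\<exists>p\<in>P. inv_divides I (LM prec ` P) (LM prec p) (LM prec f)"
    if "f \<in> two_sided_ideal hull P" "f \<noteq> 0" for f
    using that locally_involutive_basis_inv_divisor_exists[OF assms(2,4-7)]
    unfolding groebner_basis_def by blast
  then have "inv_reduces_to_zero I prec P f" if "f \<in> two_sided_ideal hull P" for f
    using that by (rule two_sided_ideal_inv_reduces_to_zero[OF assms(4,6)])
  moreover have "Poly_Mapping.single u c * p * Poly_Mapping.single v d \<in> two_sided_ideal hull P"
    if "p \<in> P" for p u v c d
    using two_sided_ideal_mult_mult[OF two_sided_ideal_hull hull_inc[OF that]] .
  ultimately show ?thesis
    using assms(7) unfolding involutive_basis_def locally_involutive_basis_def by blast
qed

end
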